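(* Let $\mathbb{k}$ be an algebraically closed field of characteristic $p>0$ and let $L$ be a finite dimensional Lie algebra over $\mathbb{k}$. Let $\overline{L}$ be the restricted closure of $\operatorname{ad}(L)$ in $\operatorname{Der}(L)$. Then for all $D, D' \in \overline{L}$ there is an isomorphism of associative $\mathbb{k}$-algebras $U(L_D) \cong U(L_{D'})$.
   Context: $\operatorname{Der}(L)$ is the Lie algebra of $\mathbb{k}$-linear derivations of $L$, which is a restricted Lie algebra under the $p$-th power map $D \mapsto D^p$ (composition of endomorphisms). The restricted closure $\overline{L}$ of $\operatorname{ad}(L)$ is the smallest restricted subalgebra of $\operatorname{Der}(L)$ (Lie subalgebra closed under $D \mapsto D^p$) containing $\operatorname{ad}(L)$. For $D \in \operatorname{Der}(L)$, $L_D$ denotes the semidirect product $L \rtimes \mathbb{k}D$, i.e. the Lie algebra with underlying vector space $L \oplus \mathbb{k}D$ in which $D$ is regarded as a formal new basis vector (so $\dim L_D = \dim L + 1$ even if $D$ is the zero derivation), $L$ is an ideal with its given bracket, and $[D,X] = D(X)$ for $X \in L$. $U(\cdot)$ denotes the universal enveloping algebra. *)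

theory Defs
  imports
    "HOL-Algebra.Algebraic_Closure_Type"
    "HOL-Algebra.QuotRing"
    "HOL-Library.Poly_Mapping"
    "HOL-Library.Product_Plus"
begin

locale lie_algebra = Vector_Spaces.vector_space scale
  for scale :: "'k::field \<Rightarrow> 'l::ab_group_add \<Rightarrow> 'l" +
  fixes br :: "'l \<Rightarrow> 'l \<Rightarrow> 'l"
  assumes br_add_left: "br (x + y) z = br x z + br y z"
    and br_add_right: "br x (y + z) = br x y + br x z"
    and br_scale_left: "br (scale c x) y = scale c (br x y)"
    and br_scale_right: "br x (scale c y) = scale c (br x y)"
    and br_self: "br x x = 0"
    and jacobi: "br x (br y z) + br y (br z x) + br z (br x y) = 0"

definition derivations ::
  "('k::field \<Rightarrow> 'l::ab_group_add \<Rightarrow> 'l) \<Rightarrow> ('l \<Rightarrow> 'l \<Rightarrow> 'l) \<Rightarrow> ('l \<Rightarrow> 'l) set" where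
  "derivations scale br =
     {D. Vector_Spaces.linear scale scale D \<and> (\<forall>x y. D (br x y) = br (D x) y + br x (D y))}"

definition restricted_subalgebra_of_derivations ::
  "nat \<Rightarrow> ('k::field \<Rightarrow> 'l::ab_group_add \<Rightarrow> 'l) \<Rightarrow> ('l \<Rightarrow> 'l \<Rightarrow> 'l) \<Rightarrow> ('l \<Rightarrow> 'l) set \<Rightarrow> bool" where
  "restricted_subalgebra_of_derivations p scale br S \<longleftrightarrow>
     S \<subseteq> derivations scale br \<and>
     (\<lambda>x. 0) \<in> S \<and>
     (\<forall>D\<in>S. \<forall>E\<in>S. (\<lambda>x. D x + E x) \<in> S) \<and>
     (\<forall>c. \<forall>D\<in>S. (\<lambda>x. scale c (D x)) \<in> S) \<and>
     (\<forall>D\<in>S. \<forall>E\<in>S. (\<lambda>x. D (E x) - E (D x)) \<in> S) \<and>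
     (\<forall>D\<in>S. D ^^ p \<in> S)"

definition restricted_closure ::
  "nat \<Rightarrow> ('k::field \<Rightarrow> 'l::ab_group_add \<Rightarrow> 'l) \<Rightarrow> ('l \<Rightarrow> 'l \<Rightarrow> 'l) \<Rightarrow> ('l \<Rightarrow> 'l) set" where
  "restricted_closure p scale br =
     \<Inter>{S. restricted_subalgebra_of_derivations p scale br S \<and> range br \<subseteq> S}"
  \<comment> \<open>the partial application \<open>br x\<close> is \<open>ad x\<close>, so \<open>range br\<close> is \<open>ad(L)\<close>\<close>

text \<open>In \<open>L \<rtimes> kD\<close> the pair \<open>(x, a)\<close> stands for \<open>x + a D\<close>; the second component is
  a formal coordinate, so the sum is direct even if \<open>D = 0\<close>.\<close>

definition semidirect_scale ::
  "('k::field \<Rightarrow> 'l::ab_group_add \<Rightarrow> 'l) \<Rightarrow> 'k \<Rightarrow> 'l \<times> 'k \<Rightarrow> 'l \<times> 'k" where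
  "semidirect_scale scale c = (\<lambda>(x, a). (scale c x, c * a))"

definition semidirect_bracket ::
  "('k::field \<Rightarrow> 'l::ab_group_add \<Rightarrow> 'l) \<Rightarrow> ('l \<Rightarrow> 'l \<Rightarrow> 'l) \<Rightarrow> ('l \<Rightarrow> 'l) \<Rightarrow>
     'l \<times> 'k \<Rightarrow> 'l \<times> 'k \<Rightarrow> 'l \<times> 'k" where
  "semidirect_bracket scale br D =
     (\<lambda>(x, a) (y, b). (br x y + scale a (D y) - scale b (D x), 0))"

text \<open>Words form a monoid under concatenation, written additively so that
  \<^typ>\<open>'l list \<Rightarrow>\<^sub>0 'k\<close> is, with its convolution product, the free associative algebra
  on the set \<^typ>\<open>'l\<close>.\<close>

instantiation list :: (type) monoid_add
begin

definition zero_list :: "'a list" where "zero_list = []"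

definition plus_list :: "'a list \<Rightarrow> 'a list \<Rightarrow> 'a list" where "plus_list = (@)"

instance
  by standard (simp_all add: zero_list_def plus_list_def)

end

definition scalar :: "'k \<Rightarrow> 'l list \<Rightarrow>\<^sub>0 'k::ring_1" where
  "scalar c = Poly_Mapping.single [] c"

definition gen :: "'l \<Rightarrow> 'l list \<Rightarrow>\<^sub>0 'k::ring_1" where
  "gen x = Poly_Mapping.single [x] 1"

text \<open>The first two families of relations cut the free algebra on the underlying set of \<open>L\<close>
  down to the tensor algebra \<open>T(L)\<close>, the third one cuts \<open>T(L)\<close> down to \<open>U(L)\<close>.\<close>

definition enveloping_relations ::
  "('k::field \<Rightarrow> 'l::ab_group_add \<Rightarrow> 'l) \<Rightarrow> ('l \<Rightarrow> 'l \<Rightarrow> 'l) \<Rightarrow> ('l list \<Rightarrow>\<^sub>0 'k) set" where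
  "enveloping_relations scale br =
     {gen (x + y) - (gen x + gen y) | x y. True} \<union>
     {gen (scale c x) - scalar c * gen x | c x. True} \<union>
     {gen x * gen y - gen y * gen x - gen (br x y) | x y. True}"

definition enveloping_ideal ::
  "('k::field \<Rightarrow> 'l::ab_group_add \<Rightarrow> 'l) \<Rightarrow> ('l \<Rightarrow> 'l \<Rightarrow> 'l) \<Rightarrow> ('l list \<Rightarrow>\<^sub>0 'k) set" where
  "enveloping_ideal scale br = genideal ring_of_type_algebra (enveloping_relations scale br)"

definition universal_enveloping_algebra ::
  "('k::field \<Rightarrow> 'l::ab_group_add \<Rightarrow> 'l) \<Rightarrow> ('l \<Rightarrow> 'l \<Rightarrow> 'l) \<Rightarrow>
     ('k, ('l list \<Rightarrow>\<^sub>0 'k) set) module" where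
  "universal_enveloping_algebra scale br =
     (let F = ring_of_type_algebra; I = enveloping_ideal scale br; Q = F Quot I
      in ring.extend Q (module.fields (\<lambda>c A. (I +>\<^bsub>F\<^esub> scalar c) \<otimes>\<^bsub>Q\<^esub> A)))"

definition algebra_iso :: "('k, 'a) module \<Rightarrow> ('k, 'b) module \<Rightarrow> ('a \<Rightarrow> 'b) set" where
  "algebra_iso A B =
     {h \<in> ring_iso A B. \<forall>c. \<forall>x \<in> carrier A. h (c \<odot>\<^bsub>A\<^esub> x) = c \<odot>\<^bsub>B\<^esub> h x}"

definition algebra_isomorphic :: "('k, 'a) module \<Rightarrow> ('k, 'b) module \<Rightarrow> bool" where
  "algebra_isomorphic A B \<longleftrightarrow> algebra_iso A B \<noteq> {}"

text \<open>The intersection defining \<^const>\<open>restricted_closure\<close> is over a nonempty family: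
  in characteristic \<open>p\<close> the Lie algebra of all derivations is itself restricted.\<close>

context lie_algebra
begin

lemma br_zero_left [simp]: "br 0 y = 0" and br_zero_right [simp]: "br x 0 = 0"
  using br_add_left[of 0 0 y] br_add_right[of x 0 0] by simp_all

lemma br_minus_left: "br (- x) y = - br x y" and br_minus_right: "br x (- y) = - br x y"
  using br_add_left[of x "- x" y] br_add_right[of x y "- y"]
  by (simp_all add: eq_neg_iff_add_eq_0 add.commute)

lemma br_diff_left: "br (x - y) z = br x z - br y z"
  and br_diff_right: "br x (y - z) = br x y - br x z"
  using br_add_left[of x "- y" z] br_add_right[of x y "- z"]
  by (simp_all add: br_minus_left br_minus_right)

lemma br_antisym: "br y x = - br x y"
proof -
  have "br (x + y) (x + y) = br x y + br y x"
    unfolding br_add_left br_add_right by (simp add: br_self)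
  then show ?thesis
    by (simp add: br_self eq_neg_iff_add_eq_0 add.commute)
qed

lemma jacobi': "br x (br y z) = br (br x y) z + br y (br x z)"
proof -
  have "br x (br y z) = - (br y (br z x) + br z (br x y))"
    using jacobi[of x y z] by (simp only: eq_neg_iff_add_eq_0 add.assoc)
  also have "\<dots> = br (br x y) z + br y (br x z)"
    using br_antisym[of z "br x y"] br_antisym[of z x] by (simp add: br_minus_right)
  finally show ?thesis .
qed

lemma derivations_iff:
  "D \<in> derivations scale br \<longleftrightarrow>
     (\<forall>x y. D (x + y) = D x + D y) \<and> (\<forall>c x. D (scale c x) = scale c (D x)) \<and>
     (\<forall>x y. D (br x y) = br (D x) y + br x (D y))"
  unfolding derivations_def Vector_Spaces.linear_iff by (auto intro: vector_space_axioms)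

lemma derivation_power:
  assumes "D \<in> derivations scale br"
  shows "(D ^^ n) (x + y) = (D ^^ n) x + (D ^^ n) y"
    and "(D ^^ n) (scale c x) = scale c ((D ^^ n) x)"
  using assms by (induction n) (auto simp: derivations_iff)

lemma leibniz:
  assumes "D \<in> derivations scale br"
  shows "(D ^^ n) (br x y) =
    (\<Sum>i\<le>n. scale (of_nat (n choose i)) (br ((D ^^ i) x) ((D ^^ (n - i)) y)))"
proof (induction n)
  case (Suc n)
  define T where "T = (\<lambda>i j. br ((D ^^ i) x) ((D ^^ j) y))"
  interpret D: Vector_Spaces.linear scale scale D
    using assms by (simp add: derivations_def)
  have DT: "D (T i j) = T (Suc i) j + T i (Suc j)" for i j
    using assms by (simp add: T_def derivations_iff)
  have "(D ^^ Suc n) (br x y) = D (\<Sum>i\<le>n. scale (of_nat (n choose i)) (T i (n - i)))"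
    using Suc by (simp add: T_def)
  also have "\<dots> = (\<Sum>i\<le>n. scale (of_nat (n choose i)) (T (Suc i) (n - i))) +
      (\<Sum>i\<le>n. scale (of_nat (n choose i)) (T i (Suc (n - i))))"
    by (simp add: D.sum D.scale DT scale_right_distrib sum.distrib)
  also have "(\<Sum>i\<le>n. scale (of_nat (n choose i)) (T i (Suc (n - i)))) =
      (\<Sum>i\<le>Suc n. scale (of_nat (n choose i)) (T i (Suc n - i)))"
    by (simp add: Suc_diff_le binomial_eq_0)
  also have "\<dots> = T 0 (Suc n) +
      (\<Sum>i\<le>n. scale (of_nat (n choose Suc i)) (T (Suc i) (n - i)))"
    by (subst sum.atMost_Suc_shift) simp
  also have "(\<Sum>i\<le>n. scale (of_nat (n choose i)) (T (Suc i) (n - i))) +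
        (T 0 (Suc n) + (\<Sum>i\<le>n. scale (of_nat (n choose Suc i)) (T (Suc i) (n - i)))) =
      (\<Sum>i\<le>Suc n. scale (of_nat (Suc n choose i)) (T i (Suc n - i)))"
    unfolding sum.atMost_Suc_shift[of _ n]
    by (simp add: scale_left_distrib sum.distrib add.assoc add.left_commute)
  finally show ?case
    by (simp only: T_def)
qed simp

lemma derivations_power_CHAR:
  assumes D: "D \<in> derivations scale br" and p: "CHAR('k) = p" "p > 0"
  shows "D ^^ p \<in> derivations scale br"
proof -
  have "prime p"
    using p prime_CHAR_semidom[where ?'a = 'k] by simp
  have "(D ^^ p) (br x y) = br ((D ^^ p) x) y + br x ((D ^^ p) y)" for x y
  proof -
    have "of_nat (p choose i) = (0 :: 'k)" if "i \<in> {..p} - {0, p}" for i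
      using that \<open>prime p\<close> p of_nat_eq_0_iff_char_dvd[of "p choose i", where ?'a = 'k]
      by (auto intro!: dvd_choose_prime)
    then have "(D ^^ p) (br x y) =
        (\<Sum>i\<in>{0, p}. scale (of_nat (p choose i)) (br ((D ^^ i) x) ((D ^^ (p - i)) y)))"
      unfolding leibniz[OF D] by (intro sum.mono_neutral_right) auto
    then show ?thesis
      using p(2) by simp
  qed
  then show ?thesis
    using derivation_power[OF D] by (simp add: derivations_iff)
qed

lemma derivations_restricted:
  assumes "CHAR('k) = p" "p > 0"
  shows "restricted_subalgebra_of_derivations p scale br (derivations scale br)"
  unfolding restricted_subalgebra_of_derivations_def
proof (intro conjI ballI allI)
  show "D ^^ p \<in> derivations scale br" if "D \<in> derivations scale br" for D
    using derivations_power_CHAR[OF that assms] .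
  show "(\<lambda>x. 0) \<in> derivations scale br"
    by (simp add: derivations_iff)
next
  fix D E assume "D \<in> derivations scale br" "E \<in> derivations scale br"
  then show "(\<lambda>x. D x + E x) \<in> derivations scale br"
    and "(\<lambda>x. D (E x) - E (D x)) \<in> derivations scale br"
    by (simp_all add: derivations_iff br_add_left br_add_right br_diff_left br_diff_right
        scale_right_distrib scale_right_diff_distrib)
next
  fix c D assume "D \<in> derivations scale br"
  then show "(\<lambda>x. scale c (D x)) \<in> derivations scale br"
    by (simp add: derivations_iff br_scale_left br_scale_right scale_right_distrib
        scale_left_commute)
qed simp

lemma ad_derivations: "range br \<subseteq> derivations scale br"
  by (auto simp: derivations_iff br_add_right br_scale_right intro: jacobi')

lemma restricted_closure_subset:
  assumes "CHAR('k) = p" "p > 0"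
  shows "restricted_closure p scale br \<subseteq> derivations scale br"
  using derivations_restricted[OF assms] ad_derivations
  by (auto simp: restricted_closure_def)

lemma semidirect_lie_algebra:
  assumes "D \<in> derivations scale br"
  shows "lie_algebra (semidirect_scale scale) (semidirect_bracket scale br D)"
proof -
  note simps = semidirect_scale_def semidirect_bracket_def br_add_left br_add_right
    br_diff_left br_diff_right br_scale_left br_scale_right br_self
    scale_right_distrib scale_right_diff_distrib scale_left_distrib
  have D: "D (x + y) = D x + D y" "D (scale c x) = scale c (D x)"
      "D (br x y) = br (D x) y + br x (D y)" for x y c
    using assms by (auto simp: derivations_iff)
  interpret D: Vector_Spaces.linear scale scale D
    using assms by (simp add: derivations_def)
  have vs: "Vector_Spaces.vector_space (semidirect_scale scale)"
    by unfold_locales (auto simp: simps algebra_simps)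
  show ?thesis
  proof (intro lie_algebra.intro lie_algebra_axioms.intro vs)
    fix x y z
    show "semidirect_bracket scale br D x (semidirect_bracket scale br D y z) +
        semidirect_bracket scale br D y (semidirect_bracket scale br D z x) +
        semidirect_bracket scale br D z (semidirect_bracket scale br D x y) = 0"
    proof (cases x, cases y, cases z)
      fix x1 a y1 b z1 c
      assume xyz: "x = (x1, a)" "y = (y1, b)" "z = (z1, c)"
      have J: "br x1 (br y1 z1) = br (br x1 y1) z1 + br y1 (br x1 z1)"
        by (rule jacobi')
      have "br z1 (br x1 y1) = - br (br x1 y1) z1" "br y1 (br z1 x1) = - br y1 (br x1 z1)"
        "br x1 (D y1) = - br (D y1) x1" "br x1 (D z1) = - br (D z1) x1"
        "br y1 (D x1) = - br (D x1) y1" "br y1 (D z1) = - br (D z1) y1"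
        "br z1 (D x1) = - br (D x1) z1" "br z1 (D y1) = - br (D y1) z1"
        by (rule br_antisym, subst br_antisym, rule br_minus_right, (rule br_antisym)+)
      with J show ?thesis
        unfolding xyz
        by (simp add: simps D D.diff zero_prod_def mult.commute)
    qed
  qed (auto simp: simps D zero_prod_def algebra_simps)
qed

end

lemma free_algebra_ring: "ring (ring_of_type_algebra :: ('l list \<Rightarrow>\<^sub>0 'k::field) ring)"
  by (rule ringI; (rule abelian_groupI monoidI)?)
     (auto simp: ring_of_type_algebra_def algebra_simps intro: exI[of _ "- x" for x])

lemma enveloping_ideal_ideal:
  "ideal (enveloping_ideal scale br) (ring_of_type_algebra :: ('l::ab_group_add list \<Rightarrow>\<^sub>0 'k::field) ring)"
  unfolding enveloping_ideal_def
  by (rule ring.genideal_ideal[OF free_algebra_ring]) (simp add: ring_of_type_algebra_def)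

lemma scalar_add: "scalar (a + b) = scalar a + scalar b"
  and scalar_mult: "scalar (a * b) = scalar a * scalar b"
  and scalar_one: "scalar 1 = 1"
  by (simp_all add: scalar_def single_add mult_single plus_list_def)
     (simp flip: zero_list_def)

lemma scalar_central: "scalar c * f = f * scalar (c :: 'k::field)"
proof (induction f rule: update_induct)
  case (update f w a)
  have "Poly_Mapping.update w a f = f + Poly_Mapping.single w a"
    using update by (intro poly_mapping_eqI)
      (auto simp: lookup_update lookup_add lookup_single when_def in_keys_iff)
  moreover have "scalar c * Poly_Mapping.single w a = Poly_Mapping.single w a * scalar c"
    by (simp add: scalar_def mult_single plus_list_def mult.commute)
  ultimately show ?case
    using update by (simp add: algebra_simps)
qed simp

lemma ring_extend:
  assumes "ring Q"
  shows "ring (ring.extend Q m)"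
proof -
  interpret Q: ring Q by fact
  have [simp]: "carrier (ring.extend Q m) = carrier Q" "monoid.mult (ring.extend Q m) = monoid.mult Q"
    "one (ring.extend Q m) = one Q" "ring.zero (ring.extend Q m) = ring.zero Q"
    "add (ring.extend Q m) = add Q"
    by (simp_all add: ring.defs)
  show ?thesis
    by (rule ringI; (rule abelian_groupI monoidI)?)
       (auto simp: Q.a_assoc Q.m_assoc Q.l_distr Q.r_distr Q.a_lcomm Q.a_comm intro: Q.l_neg)
qed

lemma universal_enveloping_algebra_ring:
  "ring (universal_enveloping_algebra scale br)"
  unfolding universal_enveloping_algebra_def Let_def
  by (intro ring_extend ideal.quotient_is_ring enveloping_ideal_ideal)

lemma universal_enveloping_algebra_algebra:
  fixes scale :: "'k::field \<Rightarrow> 'l::ab_group_add \<Rightarrow> 'l" and br :: "'l \<Rightarrow> 'l \<Rightarrow> 'l"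
  defines "U \<equiv> universal_enveloping_algebra scale br"
  shows "module ring_of_type_algebra U"
    and "\<lbrakk>x \<in> carrier U; y \<in> carrier U\<rbrakk> \<Longrightarrow> (c \<odot>\<^bsub>U\<^esub> x) \<otimes>\<^bsub>U\<^esub> y = c \<odot>\<^bsub>U\<^esub> (x \<otimes>\<^bsub>U\<^esub> y)"
    and "\<lbrakk>x \<in> carrier U; y \<in> carrier U\<rbrakk> \<Longrightarrow> x \<otimes>\<^bsub>U\<^esub> (c \<odot>\<^bsub>U\<^esub> y) = c \<odot>\<^bsub>U\<^esub> (x \<otimes>\<^bsub>U\<^esub> y)"
proof -
  define F where "F = (ring_of_type_algebra :: ('l list \<Rightarrow>\<^sub>0 'k) ring)"
  define I where "I = enveloping_ideal scale br"
  define q where "q = (\<lambda>f. I +>\<^bsub>F\<^esub> f)"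
  interpret I: ideal I F
    unfolding I_def F_def by (rule enveloping_ideal_ideal)
  interpret U: ring U
    unfolding U_def by (rule universal_enveloping_algebra_ring)
  have F: "carrier F = UNIV" "f \<oplus>\<^bsub>F\<^esub> g = f + g" "f \<otimes>\<^bsub>F\<^esub> g = f * g" "\<one>\<^bsub>F\<^esub> = 1" for f g
    by (simp_all add: F_def ring_of_type_algebra_def)
  have U: "carrier U = carrier (F Quot I)" "monoid.mult U = monoid.mult (F Quot I)"
    "add U = add (F Quot I)" "one U = one (F Quot I)" "c \<odot>\<^bsub>U\<^esub> x = q (scalar c) \<otimes>\<^bsub>F Quot I\<^esub> x" for c x
    by (simp_all add: U_def universal_enveloping_algebra_def F_def I_def q_def Let_def
        ring.defs module.defs)
  have carrier: "carrier U = range q"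
    by (auto simp: U q_def FactRing_def A_RCOSETS_def' F)
  have q: "q f \<oplus>\<^bsub>U\<^esub> q g = q (f + g)" "q f \<otimes>\<^bsub>U\<^esub> q g = q (f * g)" "\<one>\<^bsub>U\<^esub> = q 1"
      "c \<odot>\<^bsub>U\<^esub> q f = q (scalar c * f)" for f g c
    using I.rcos_ring_hom by (auto simp: U q_def ring_hom_def F)
  show "module ring_of_type_algebra U"
    by (rule moduleI)
       (auto simp: carrier q scalar_add scalar_mult scalar_one algebra_simps ring_of_type_algebra_def
          intro: U.abelian_group_axioms cring_from_type_algebra[unfolded ring_of_type_algebra_def])
  show "(c \<odot>\<^bsub>U\<^esub> x) \<otimes>\<^bsub>U\<^esub> y = c \<odot>\<^bsub>U\<^esub> (x \<otimes>\<^bsub>U\<^esub> y)" if "x \<in> carrier U" "y \<in> carrier U"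
    using that by (auto simp: carrier q mult.assoc)
  show "x \<otimes>\<^bsub>U\<^esub> (c \<odot>\<^bsub>U\<^esub> y) = c \<odot>\<^bsub>U\<^esub> (x \<otimes>\<^bsub>U\<^esub> y)" if "x \<in> carrier U" "y \<in> carrier U"
    using that by (auto simp: carrier q scalar_central mult.assoc)
qed

end

theory Submission
  imports Defs
begin

text \<open>The derivations \<open>D\<close> of \<open>L\<close> for which some \<open>u \<in> U(L)\<close> satisfies \<open>[u, x] = D x\<close> for
  all \<open>x \<in> L\<close> form a restricted subalgebra containing \<open>ad(L)\<close>, because \<open>ad(u)\<^sup>p = ad(u\<^sup>p)\<close> in
  characteristic \<open>p\<close>; hence every \<open>D\<close> in the restricted closure has such a \<open>u\<^sub>D\<close>.
  Then the identity of \<open>L\<close> together with \<open>D \<mapsto> D' + u\<^sub>D - u\<^sub>D\<^sub>'\<close> induces a homomorphism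
  \<open>U(L\<^sub>D) \<rightarrow> U(L\<^sub>D\<^sub>')\<close>, and exchanging the roles of \<open>D\<close> and \<open>D'\<close> gives its inverse.\<close>

section \<open>Ideals of the free algebra in type class notation\<close>

lemma type_algebra_simps [simp]:
  "carrier ring_of_type_algebra = UNIV" "monoid.mult ring_of_type_algebra = (*)"
  "add ring_of_type_algebra = (+)" "one ring_of_type_algebra = 1"
  "ring.zero ring_of_type_algebra = 0"
  by (simp_all add: ring_of_type_algebra_def fun_eq_iff)

lemma type_algebra_uminus:
  "\<ominus>\<^bsub>ring_of_type_algebra\<^esub> f = - (f :: 'a list \<Rightarrow>\<^sub>0 'k::field)"
proof -
  interpret ring "ring_of_type_algebra :: ('a list \<Rightarrow>\<^sub>0 'k) ring"
    by (rule free_algebra_ring)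
  show ?thesis
    by (rule minus_equality) simp_all
qed

lemma
  fixes J :: "('a list \<Rightarrow>\<^sub>0 'k::field) set"
  assumes "ideal J ring_of_type_algebra"
  shows ideal_zero: "0 \<in> J"
    and ideal_add: "f \<in> J \<Longrightarrow> g \<in> J \<Longrightarrow> f + g \<in> J"
    and ideal_uminus: "f \<in> J \<Longrightarrow> - f \<in> J"
    and ideal_diff: "f \<in> J \<Longrightarrow> g \<in> J \<Longrightarrow> f - g \<in> J"
    and ideal_mult_left: "f \<in> J \<Longrightarrow> h * f \<in> J"
    and ideal_mult_right: "f \<in> J \<Longrightarrow> f * h \<in> J"
    and ideal_commutator: "f \<in> J \<Longrightarrow> h * f - f * h \<in> J"
proof -
  interpret ideal J "ring_of_type_algebra" by fact
  show "0 \<in> J"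
    using additive_subgroup.zero_closed[OF additive_subgroup_axioms] by simp
  show add: "f + g \<in> J" if "f \<in> J" "g \<in> J" for f g
    using additive_subgroup.a_closed[OF additive_subgroup_axioms that] by simp
  show uminus: "- f \<in> J" if "f \<in> J" for f
    using additive_subgroup.a_inv_closed[OF additive_subgroup_axioms that] by (simp add: type_algebra_uminus)
  show diff: "f - g \<in> J" if "f \<in> J" "g \<in> J" for f g
    using add[OF that(1) uminus[OF that(2)]] by simp
  show mult: "h * f \<in> J" "f * h \<in> J" if "f \<in> J" for f
    using I_l_closed[OF that, of h] I_r_closed[OF that, of h] by simp_all
  show "h * f - f * h \<in> J" if "f \<in> J"
    by (intro diff mult that)
qed

lemma ideal_sum:
  assumes "ideal J ring_of_type_algebra" "\<And>i. i \<in> A \<Longrightarrow> f i \<in> J"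
  shows "sum f A \<in> (J :: ('a list \<Rightarrow>\<^sub>0 'k::field) set)"
  using assms(2)
  by (induction A rule: infinite_finite_induct)
     (auto intro: ideal_zero[OF assms(1)] ideal_add[OF assms(1)])

lemma scalar_zero [simp]: "scalar 0 = 0"
  by (simp add: scalar_def)

lemma scalar_of_nat: "scalar (of_nat n) = of_nat n"
  by (induction n) (simp_all add: scalar_add scalar_one)

lemma scalar_left_commute: "f * (scalar c * g) = scalar c * (f * (g :: 'l list \<Rightarrow>\<^sub>0 'k::field))"
  using scalar_central[of c f] by (metis mult.assoc)


subsection \<open>Homomorphisms of free algebras\<close>

text \<open>The homomorphism of free \<open>k\<close>-algebras determined by the images
  \<open>f x\<close> of the generators. Every map between enveloping algebras below is induced by
  one of these.\<close>

definition subst :: "('a \<Rightarrow> 'b list \<Rightarrow>\<^sub>0 'k) \<Rightarrow> ('a list \<Rightarrow>\<^sub>0 'k) \<Rightarrow> ('b list \<Rightarrow>\<^sub>0 'k::field)" where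
  "subst f P = (\<Sum>w\<in>Poly_Mapping.keys P. scalar (Poly_Mapping.lookup P w) * prod_list (map f w))"

text \<open>The key set of a sum can be smaller than the union of the key sets, so additivity is
  checked over a common finite index set.\<close>

lemma subst_superset:
  assumes "finite A" "Poly_Mapping.keys P \<subseteq> A"
  shows "subst f P = (\<Sum>w\<in>A. scalar (Poly_Mapping.lookup P w) * prod_list (map f w))"
  unfolding subst_def using assms by (intro sum.mono_neutral_left) (auto simp: in_keys_iff)

lemma subst_zero [simp]: "subst f 0 = 0"
  by (simp add: subst_def)

lemma subst_single: "subst f (Poly_Mapping.single w c) = scalar c * prod_list (map f w)"
  by (subst subst_superset[of "{w}"]) auto

lemma subst_add: "subst f (P + Q) = subst f P + subst f Q"
proof -
  have "Poly_Mapping.keys (P + Q) \<subseteq> Poly_Mapping.keys P \<union> Poly_Mapping.keys Q"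
    by (rule keys_add)
  then show ?thesis
    by (simp add: subst_superset[of "Poly_Mapping.keys P \<union> Poly_Mapping.keys Q"] lookup_add scalar_add distrib_right sum.distrib)
qed

lemma subst_diff: "subst f (P - Q) = subst f P - subst f Q"
  using subst_add[of f "P - Q" Q] by simp

text \<open>Updating at a fresh word is the same as adding a monomial; in this form the induction
  step suits additive maps.\<close>

lemma free_algebra_induct [case_names zero add]:
  fixes P :: "'a list \<Rightarrow>\<^sub>0 'k::field"
  assumes "\<Phi> 0" "\<And>w c Q. \<Phi> Q \<Longrightarrow> \<Phi> (Poly_Mapping.single w c + Q)"
  shows "\<Phi> P"
proof (induction P rule: update_induct)
  case (update f w c)
  have "Poly_Mapping.update w c f = Poly_Mapping.single w c + f"
    using update by (intro poly_mapping_eqI)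
      (auto simp: lookup_update lookup_add lookup_single when_def in_keys_iff)
  then show ?case
    using update assms(2) by simp
qed (rule assms(1))

text \<open>Both sides are additive in \<open>P\<close> and in \<open>Q\<close>, which leaves
  monomials: their words concatenate, and their coefficients can be moved to the front because
  scalars are central.\<close>

lemma subst_mult: "subst f (P * Q) = subst f P * subst f Q"
proof (induction P rule: free_algebra_induct)
  case (add w c P)
  have "subst f (Poly_Mapping.single w c * Q) = subst f (Poly_Mapping.single w c) * subst f Q"
  proof (induction Q rule: free_algebra_induct)
    case (add v d Q)
    then show ?case
      by (simp add: distrib_left subst_add mult_single subst_single plus_list_def scalar_mult
          mult.assoc scalar_left_commute[of "prod_list (map f w)"])
  qed simp
  with add show ?case
    by (simp add: distrib_right subst_add)
qed simp

lemma subst_scalar [simp]: "subst f (scalar c) = scalar c"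
  using subst_single[of f "[]" c] by (simp flip: scalar_def)

lemma subst_one [simp]: "subst f 1 = 1"
  using subst_scalar[of f 1] by (simp add: scalar_one)

lemma subst_gen [simp]: "subst f (gen x) = f x"
  by (simp add: gen_def subst_single scalar_one)

lemma subst_subst: "subst f (subst g P) = subst (\<lambda>x. subst f (g x)) P"
proof (induction P rule: free_algebra_induct)
  case (add w c P)
  have "subst f (prod_list (map g w)) = prod_list (map (\<lambda>x. subst f (g x)) w)"
    by (induction w) (simp_all add: subst_mult)
  with add show ?case
    by (simp add: subst_add subst_single subst_mult)
qed simp

lemma prod_list_gen: "prod_list (map gen w) = Poly_Mapping.single w 1"
proof (induction w)
  case Nil
  show ?case by (simp, simp flip: zero_list_def)
qed (simp add: gen_def mult_single plus_list_def)

lemma subst_gen_id: "subst gen P = P"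
  by (induction P rule: free_algebra_induct)
     (simp_all add: subst_add subst_single prod_list_gen scalar_def mult_single plus_list_def)

text \<open>Within a word the letters are exchanged one at a time by
  \<open>a * b - c * d = (a - c) * b + c * (b - d)\<close>; every resulting summand has a factor in
  \<open>J\<close>.\<close>

lemma subst_cong_ideal:
  assumes J: "ideal J ring_of_type_algebra" and fg: "\<And>x. f x - g x \<in> J"
  shows "subst f P - subst g P \<in> J"
proof -
  have "prod_list (map f w) - prod_list (map g w) \<in> J" for w
  proof (induction w)
    case (Cons x w)
    have "prod_list (map f (x # w)) - prod_list (map g (x # w)) =
        (f x - g x) * prod_list (map f w) + g x * (prod_list (map f w) - prod_list (map g w))"
      by (simp add: algebra_simps)
    also have "\<dots> \<in> J"
      using Cons by (intro ideal_add[OF J] ideal_mult_left[OF J] ideal_mult_right[OF J] fg)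
    finally show ?case .
  qed (simp add: ideal_zero[OF J])
  then have "(\<Sum>w\<in>Poly_Mapping.keys P. scalar (Poly_Mapping.lookup P w) * (prod_list (map f w) - prod_list (map g w))) \<in> J"
    by (intro ideal_sum[OF J] ideal_mult_left[OF J])
  then show ?thesis
    by (simp add: subst_def sum_subtractf right_diff_distrib)
qed

lemma subst_vimage_ideal:
  fixes f :: "'a \<Rightarrow> 'b list \<Rightarrow>\<^sub>0 'k::field"
  assumes "ideal J ring_of_type_algebra"
  shows "ideal (subst f -` J) ring_of_type_algebra"
proof (rule idealI)
  interpret R: ring "ring_of_type_algebra :: ('a list \<Rightarrow>\<^sub>0 'k) ring"
    by (rule free_algebra_ring)
  show "ring (ring_of_type_algebra :: ('a list \<Rightarrow>\<^sub>0 'k) ring)" ..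
  show "subgroup (subst f -` J) (add_monoid ring_of_type_algebra)"
  proof (rule R.add.subgroupI)
    fix P assume P: "P \<in> subst f -` J"
    have "subst f (- P) = - subst f P"
      using subst_diff[of f 0 P] by simp
    with P show "\<ominus>\<^bsub>ring_of_type_algebra\<^esub> P \<in> subst f -` J"
      by (simp add: type_algebra_uminus ideal_uminus[OF assms])
  next
    show "subst f -` J \<noteq> {}"
      using ideal_zero[OF assms] subst_zero[of f] by (metis empty_iff vimageI)
  qed (auto simp: subst_add intro: ideal_add[OF assms])
qed (auto simp: subst_mult intro: ideal_mult_left[OF assms] ideal_mult_right[OF assms])

section \<open>Homomorphisms and isomorphisms of enveloping algebras\<close>

lemma enveloping_ideal_relations: "enveloping_relations scale br \<subseteq> enveloping_ideal scale br"
  unfolding enveloping_ideal_def by (rule ring.genideal_self[OF free_algebra_ring]) simp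

lemma
  shows enveloping_add: "gen (x + y) - (gen x + gen y) \<in> enveloping_ideal scale br"
    and enveloping_scale: "gen (scale c x) - scalar c * gen x \<in> enveloping_ideal scale br"
    and enveloping_br: "gen x * gen y - gen y * gen x - gen (br x y) \<in> enveloping_ideal scale br"
  using enveloping_ideal_relations[of scale br] unfolding enveloping_relations_def by blast+

text \<open>As a one-letter word \<open>gen 0\<close> is not zero in the free algebra; the
  additivity relation for \<open>0 + 0\<close> is exactly \<open>- gen 0\<close>.\<close>

lemma enveloping_zero: "gen 0 \<in> enveloping_ideal scale br"
  using ideal_uminus[OF enveloping_ideal_ideal enveloping_add[of 0 0 scale br]] by simp

text \<open>The universal property of \<open>U(L)\<close>, with a quotient of a free algebra as
  target. The enveloping ideal is the least ideal containing the relations and preimages of ideals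
  are ideals, so only the three families of relations need checking.\<close>

lemma subst_enveloping_ideal:
  assumes J: "ideal J ring_of_type_algebra"
    and "\<And>x y. f (x + y) - (f x + f y) \<in> J"
    and "\<And>c x. f (scale c x) - scalar c * f x \<in> J"
    and "\<And>x y. f x * f y - f y * f x - f (br x y) \<in> J"
    and "P \<in> enveloping_ideal scale br"
  shows "subst f P \<in> J"
proof -
  have "enveloping_relations scale br \<subseteq> subst f -` J"
    using assms(2-4) by (auto simp: enveloping_relations_def subst_diff subst_add subst_mult)
  then have "enveloping_ideal scale br \<subseteq> subst f -` J"
    unfolding enveloping_ideal_def
    by (rule ring.genideal_minimal[OF free_algebra_ring subst_vimage_ideal[OF J]])
  with assms(5) show ?thesis by blast
qed

text \<open>The first isomorphism theorem for the composite \<open>h\<close> of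
  \<open>subst f\<close> with the projection onto the quotient by \<open>J\<close>. The map
  \<open>g\<close> serves to compute the kernel of \<open>h\<close> and to find preimages, and the
  inverse conditions are needed on generators only.\<close>

lemma algebra_isomorphicI:
  fixes f :: "'a::ab_group_add \<Rightarrow> 'b::ab_group_add list \<Rightarrow>\<^sub>0 'k::field" and s s' b b'
  defines "I \<equiv> enveloping_ideal s b" and "J \<equiv> enveloping_ideal s' b'"
  assumes f: "\<And>P. P \<in> I \<Longrightarrow> subst f P \<in> J" and g: "\<And>Q. Q \<in> J \<Longrightarrow> subst g Q \<in> I"
    and gf: "\<And>x. subst g (f x) - gen x \<in> I" and fg: "\<And>y. subst f (g y) - gen y \<in> J"
  shows "algebra_isomorphic (universal_enveloping_algebra s b) (universal_enveloping_algebra s' b')"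
proof -
  define F where "F = (ring_of_type_algebra :: ('a list \<Rightarrow>\<^sub>0 'k) ring)"
  define G where "G = (ring_of_type_algebra :: ('b list \<Rightarrow>\<^sub>0 'k) ring)"
  define U where "U = universal_enveloping_algebra s b"
  define V where "V = universal_enveloping_algebra s' b'"
  define q where "q = (\<lambda>P. I +>\<^bsub>F\<^esub> P)"
  define r where "r = (\<lambda>Q. J +>\<^bsub>G\<^esub> Q)"
  define h where "h = r \<circ> subst f"
  interpret I: ideal I F
    unfolding I_def F_def by (rule enveloping_ideal_ideal)
  interpret J: ideal J G
    unfolding J_def G_def by (rule enveloping_ideal_ideal)
  interpret GJ: ring "G Quot J"
    by (rule J.quotient_is_ring)
  have U: "carrier U = carrier (F Quot I)" "monoid.mult U = monoid.mult (F Quot I)"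
    "add U = add (F Quot I)" "one U = one (F Quot I)" "c \<odot>\<^bsub>U\<^esub> x = q (scalar c) \<otimes>\<^bsub>F Quot I\<^esub> x" for c x
    by (simp_all add: U_def universal_enveloping_algebra_def F_def I_def q_def Let_def
        ring.defs module.defs)
  have V: "carrier V = carrier (G Quot J)" "monoid.mult V = monoid.mult (G Quot J)"
    "add V = add (G Quot J)" "one V = one (G Quot J)" "c \<odot>\<^bsub>V\<^esub> x = r (scalar c) \<otimes>\<^bsub>G Quot J\<^esub> x" for c x
    by (simp_all add: V_def universal_enveloping_algebra_def G_def J_def r_def Let_def
        ring.defs module.defs)
  have F_simps: "carrier F = UNIV" "monoid.mult F = (*)" "add F = (+)" "one F = 1"
    and G_simps: "carrier G = UNIV" "monoid.mult G = (*)" "add G = (+)" "one G = 1"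
    by (simp_all add: F_def G_def)
  have q_hom: "q \<in> ring_hom F (F Quot I)" and r_hom: "r \<in> ring_hom G (G Quot J)"
    unfolding q_def r_def by (rule I.rcos_ring_hom J.rcos_ring_hom)+
  have r: "r P \<oplus>\<^bsub>G Quot J\<^esub> r Q = r (P + Q)" "r P \<otimes>\<^bsub>G Quot J\<^esub> r Q = r (P * Q)"
      "\<one>\<^bsub>G Quot J\<^esub> = r 1" for P Q
    using r_hom by (auto simp: ring_hom_def G_simps)
  have carriers: "carrier (F Quot I) = range q" "carrier (G Quot J) = range r"
    by (auto simp: q_def r_def FactRing_def A_RCOSETS_def' F_simps G_simps)
  have r_eq: "r P = r Q \<longleftrightarrow> P - Q \<in> J" for P Q
  proof -
    have "r P = r Q \<longleftrightarrow> P \<ominus>\<^bsub>G\<^esub> Q \<in> J"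
      unfolding r_def by (rule J.quotient_eq_iff_same_a_r_cos[symmetric]) (auto simp: G_simps J.ideal_axioms)
    then show ?thesis
      by (simp add: a_minus_def G_simps G_def type_algebra_uminus)
  qed
  have r_zero: "r P = \<zero>\<^bsub>G Quot J\<^esub> \<longleftrightarrow> P \<in> J" for P
  proof -
    have "r 0 = \<zero>\<^bsub>G Quot J\<^esub>"
      using ring_hom_zero[OF r_hom J.ring_axioms GJ.ring_axioms] by (simp add: G_def)
    then show ?thesis
      using r_eq[of P 0] by simp
  qed
  have "h \<in> ring_hom F (G Quot J)"
    by (rule ring_hom_memI) (auto simp: h_def F_simps carriers r subst_add subst_mult)
  then interpret h: ring_hom_ring F "G Quot J" h
    by (intro ring_hom_ringI2 I.ring_axioms GJ.ring_axioms)
  \<comment> \<open>Writing \<open>P\<close> as \<open>subst gen P\<close> turns this into a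
    comparison of two substitutions that agree modulo \<open>I\<close> on generators.\<close>
  have gf': "subst g (subst f P) - P \<in> I" for P
    unfolding subst_subst using gf
    by (subst (2) subst_gen_id[symmetric], intro subst_cong_ideal)
       (auto simp: I_def enveloping_ideal_ideal)
  have fg': "subst f (subst g Q) - Q \<in> J" for Q
    unfolding subst_subst using fg
    by (subst (2) subst_gen_id[symmetric], intro subst_cong_ideal)
       (auto simp: J_def enveloping_ideal_ideal)
  \<comment> \<open>Applying \<open>g\<close> puts \<open>subst g (subst f P)\<close> into
    \<open>I\<close>, and this differs from \<open>P\<close> by an element of
    \<open>I\<close>.\<close>
  have "P \<in> I" if "subst f P \<in> J" for P
    using ideal_diff[OF enveloping_ideal_ideal g[OF that, unfolded I_def] gf'[of P, unfolded I_def]]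
    by (simp add: I_def)
  then have kernel: "a_kernel F (G Quot J) h = I"
    using f by (auto simp: a_kernel_def' F_simps h_def r_zero)
  \<comment> \<open>Surjectivity: \<open>subst g Q\<close> is a preimage of the class of
    \<open>Q\<close>.\<close>
  have "h (subst g Q) = r Q" for Q
    using fg' by (simp add: h_def r_eq)
  then have "h ` carrier F = carrier (G Quot J)"
    by (auto simp: F_simps carriers h_def image_iff)
  then have iso: "(\<lambda>A. the_elem (h ` A)) \<in> ring_iso (F Quot I) (G Quot J)" (is "?h \<in> _")
    using h.FactRing_iso_set by (simp add: kernel)
  have h_q: "?h (q P) = h P" for P
    using h.the_elem_simp[of P] by (simp add: kernel q_def F_simps)
  have "?h \<in> algebra_iso U V"
    unfolding algebra_iso_def
  proof (intro CollectI conjI allI ballI)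
    show "?h \<in> ring_iso U V"
      using iso by (simp add: ring_iso_def ring_hom_def U V)
    fix c A assume "A \<in> carrier U"
    then obtain P where A: "A = q P"
      by (auto simp: U carriers)
    \<comment> \<open>Scaling by \<open>c\<close> is multiplication by the class of
      \<open>scalar c\<close>, so linearity follows from multiplicativity because
      \<open>subst f\<close> fixes scalars.\<close>
    have "c \<odot>\<^bsub>U\<^esub> A = q (scalar c * P)"
      using q_hom by (simp add: A U ring_hom_def F_simps)
    then have "?h (c \<odot>\<^bsub>U\<^esub> A) = h (scalar c * P)"
      by (simp only: h_q)
    also have "\<dots> = c \<odot>\<^bsub>V\<^esub> h P"
      by (simp add: h_def V r subst_mult)
    finally show "?h (c \<odot>\<^bsub>U\<^esub> A) = c \<odot>\<^bsub>V\<^esub> ?h A"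
      by (simp only: A h_q)
  qed
  then show ?thesis
    by (auto simp: algebra_isomorphic_def U_def V_def)
qed


subsection \<open>Derivations implemented in the enveloping algebra\<close>

text \<open>Left multiplication by \<open>u\<close> is the sum of \<open>ad u\<close>, which takes
  \<open>z i\<close> to \<open>z (Suc i)\<close>, and right multiplication by \<open>u\<close>.
  These two commute, and this is their binomial theorem applied to \<open>z 0\<close>.\<close>

lemma power_mult_commutator:
  fixes u :: "'a::ring_1"
  assumes "\<And>i. u * z i = z (Suc i) + z i * u"
  shows "u ^ n * z 0 = (\<Sum>i\<le>n. of_nat (n choose i) * (z i * u ^ (n - i)))"
proof (induction n)
  case (Suc n)
  define T where "T = (\<lambda>i j. z i * u ^ j)"
  have uT: "u * T i j = T (Suc i) j + T i (Suc j)" for i j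
    using assms[of i] by (simp add: T_def distrib_right power_commutes mult.assoc flip: mult.assoc[of u])
  have "u ^ Suc n * z 0 = u * (\<Sum>i\<le>n. of_nat (n choose i) * T i (n - i))"
    using Suc by (simp add: T_def mult.assoc)
  also have "\<dots> = (\<Sum>i\<le>n. of_nat (n choose i) * (u * T i (n - i)))"
    unfolding sum_distrib_left by (intro sum.cong refl) (metis mult.assoc mult_of_nat_commute)
  also have "\<dots> = (\<Sum>i\<le>n. of_nat (n choose i) * T (Suc i) (n - i)) +
      (\<Sum>i\<le>n. of_nat (n choose i) * T i (Suc (n - i)))"
    by (simp add: uT distrib_left sum.distrib)
  \<comment> \<open>The new summand at \<open>Suc n\<close> vanishes since
    \<open>n choose Suc n = 0\<close>; it allows the shift of the index that prepares Pascal's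
    rule.\<close>
  also have "(\<Sum>i\<le>n. of_nat (n choose i) * T i (Suc (n - i))) =
      (\<Sum>i\<le>Suc n. of_nat (n choose i) * T i (Suc n - i))"
    by (simp add: Suc_diff_le binomial_eq_0)
  also have "\<dots> = T 0 (Suc n) + (\<Sum>i\<le>n. of_nat (n choose Suc i) * T (Suc i) (n - i))"
    by (subst sum.atMost_Suc_shift) simp
  also have "(\<Sum>i\<le>n. of_nat (n choose i) * T (Suc i) (n - i)) +
        (T 0 (Suc n) + (\<Sum>i\<le>n. of_nat (n choose Suc i) * T (Suc i) (n - i))) =
      (\<Sum>i\<le>Suc n. of_nat (Suc n choose i) * T i (Suc n - i))"
    unfolding sum.atMost_Suc_shift[of _ n]
    by (simp add: distrib_right sum.distrib add.assoc add.left_commute)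
  finally show ?case
    by (simp only: T_def)
qed simp

text \<open>The inner binomial coefficients are divisible by \<open>p\<close>. The summand
  \<open>i = 0\<close> is \<open>y * u ^ p\<close> and the summand \<open>i = p\<close> is the
  iterated commutator.\<close>

lemma ad_power_CHAR:
  fixes u y :: "'l list \<Rightarrow>\<^sub>0 'k::field"
  assumes p: "CHAR('k) = p" "p > 0"
  shows "u ^ p * y - y * u ^ p = ((\<lambda>z. u * z - z * u) ^^ p) y"
proof -
  define z where "z = (\<lambda>i. ((\<lambda>z. u * z - z * u) ^^ i) y)"
  have "prime p"
    using p prime_CHAR_semidom[where ?'a = 'k] by simp
  have "of_nat (p choose i) = (0 :: 'l list \<Rightarrow>\<^sub>0 'k)" if "i \<in> {..p} - {0, p}" for i
  proof -
    have "of_nat (p choose i) = (0 :: 'k)"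
      using that \<open>prime p\<close> p of_nat_eq_0_iff_char_dvd[of "p choose i", where ?'a = 'k]
      by (auto intro!: dvd_choose_prime)
    \<comment> \<open>The characteristic is that of the field; the embedding of scalars carries the
      vanishing to the free algebra.\<close>
    then show ?thesis
      by (simp flip: scalar_of_nat)
  qed
  then have "(\<Sum>i\<le>p. of_nat (p choose i) * (z i * u ^ (p - i))) =
      (\<Sum>i\<in>{0, p}. of_nat (p choose i) * (z i * u ^ (p - i)))"
    by (intro sum.mono_neutral_right) auto
  moreover have "u ^ p * z 0 = (\<Sum>i\<le>p. of_nat (p choose i) * (z i * u ^ (p - i)))"
    by (rule power_mult_commutator) (simp add: z_def)
  ultimately show ?thesis
    using p(2) by (simp add: z_def)
qed

text \<open>In \<open>U(L)\<close> the commutator with the class of \<open>u\<close> acts on the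
  image of \<open>L\<close> as \<open>D\<close> does. Here \<open>u\<close> is a representative in
  the free algebra, to which \<open>subst\<close> applies directly.\<close>

definition implements ::
  "('k::field \<Rightarrow> 'l::ab_group_add \<Rightarrow> 'l) \<Rightarrow> ('l \<Rightarrow> 'l \<Rightarrow> 'l) \<Rightarrow> ('l list \<Rightarrow>\<^sub>0 'k) \<Rightarrow> ('l \<Rightarrow> 'l) \<Rightarrow> bool" where
  "implements scale br u D \<longleftrightarrow> (\<forall>x. u * gen x - gen x * u - gen (D x) \<in> enveloping_ideal scale br)"

context
  fixes scale :: "'k::field \<Rightarrow> 'l::ab_group_add \<Rightarrow> 'l" and br :: "'l \<Rightarrow> 'l \<Rightarrow> 'l"
begin

private abbreviation "I \<equiv> enveloping_ideal scale br"

private lemma implementsD: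
  "implements scale br u D \<Longrightarrow> u * gen x - gen x * u - gen (D x) \<in> enveloping_ideal scale br"
  by (simp add: implements_def)

private lemmas I_intros =
  ideal_commutator[OF enveloping_ideal_ideal]
  ideal_add[OF enveloping_ideal_ideal] ideal_diff[OF enveloping_ideal_ideal]
  ideal_mult_left[OF enveloping_ideal_ideal]

lemma implements_zero: "implements scale br 0 (\<lambda>x. 0)"
  unfolding implements_def
  using ideal_uminus[OF enveloping_ideal_ideal enveloping_zero[of scale br]] by simp

lemma implements_add:
  assumes "implements scale br u D" "implements scale br v E"
  shows "implements scale br (u + v) (\<lambda>x. D x + E x)"
  unfolding implements_def
proof
  fix x
  have "(u + v) * gen x - gen x * (u + v) - gen (D x + E x) =
      (u * gen x - gen x * u - gen (D x)) + (v * gen x - gen x * v - gen (E x)) -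
      (gen (D x + E x) - (gen (D x) + gen (E x)))"
    by (simp add: algebra_simps)
  also have "\<dots> \<in> I"
    by (rule implementsD assms enveloping_add I_intros)+
  finally show "(u + v) * gen x - gen x * (u + v) - gen (D x + E x) \<in> I" .
qed

lemma implements_scale:
  assumes "implements scale br u D"
  shows "implements scale br (scalar c * u) (\<lambda>x. scale c (D x))"
  unfolding implements_def
proof
  fix x
  have "scalar c * u * gen x - gen x * (scalar c * u) - gen (scale c (D x)) =
      scalar c * (u * gen x - gen x * u - gen (D x)) -
      (gen (scale c (D x)) - scalar c * gen (D x))"
    by (simp add: algebra_simps scalar_left_commute)
  also have "\<dots> \<in> I"
    by (rule implementsD assms enveloping_scale I_intros)+
  finally show "scalar c * u * gen x - gen x * (scalar c * u) - gen (scale c (D x)) \<in> I" .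
qed

lemma implements_ad: "implements scale br (gen x) (br x)"
  by (simp add: implements_def enveloping_br)

lemma implements_commutator:
  assumes u: "implements scale br u D" and v: "implements scale br v E"
    and diff: "\<And>x y. gen (x - y) - (gen x - gen y) \<in> I"
  shows "implements scale br (u * v - v * u) (\<lambda>x. D (E x) - E (D x))"
  unfolding implements_def
proof
  fix x
  define a where "a = u * gen x - gen x * u - gen (D x)"
  define b where "b = v * gen x - gen x * v - gen (E x)"
  have ab: "a \<in> I" "b \<in> I"
    using u v by (auto simp: a_def b_def implementsD)
  \<comment> \<open>This is the Jacobi identity for \<open>u\<close>, \<open>v\<close> and
    \<open>gen x\<close>. The errors \<open>a\<close> and \<open>b\<close> occur inside commutators,
    which stay in the ideal; the last summand is there because \<open>gen\<close> respects
    differences only modulo the ideal.\<close>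
  have "(u * v - v * u) * gen x - gen x * (u * v - v * u) - gen (D (E x) - E (D x)) =
      (u * b - b * u) - (v * a - a * v) +
      (u * gen (E x) - gen (E x) * u - gen (D (E x))) -
      (v * gen (D x) - gen (D x) * v - gen (E (D x))) -
      (gen (D (E x) - E (D x)) - (gen (D (E x)) - gen (E (D x))))"
    by (simp add: a_def b_def algebra_simps)
  also have "\<dots> \<in> I"
    by (rule ab implementsD u v diff I_intros)+
  finally show "(u * v - v * u) * gen x - gen x * (u * v - v * u) - gen (D (E x) - E (D x)) \<in> I" .
qed

text \<open>By induction \<open>ad(u)^n\<close> takes \<open>gen x\<close> to
  \<open>gen ((D ^^ n) x)\<close> modulo the ideal, for every \<open>n\<close>. The characteristic
  enters through \<open>ad_power_CHAR\<close>, which identifies \<open>ad(u)^p\<close> with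
  \<open>ad(u^p)\<close>.\<close>

lemma implements_power_CHAR:
  assumes u: "implements scale br u D" and p: "CHAR('k) = p" "p > 0"
  shows "implements scale br (u ^ p) (D ^^ p)"
  unfolding implements_def ad_power_CHAR[OF p]
proof
  fix x
  define A where "A = (\<lambda>z. u * z - z * u)"
  have "(A ^^ n) (gen x) - gen ((D ^^ n) x) \<in> I" for n
  proof (induction n)
    case (Suc n)
    define a where "a = (A ^^ n) (gen x) - gen ((D ^^ n) x)"
    have a: "a \<in> I"
      using Suc by (simp add: a_def)
    have "(A ^^ Suc n) (gen x) - gen ((D ^^ Suc n) x) =
        (u * a - a * u) + (u * gen ((D ^^ n) x) - gen ((D ^^ n) x) * u - gen (D ((D ^^ n) x)))"
      by (simp add: a_def A_def algebra_simps)
    also have "\<dots> \<in> I"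
      by (rule a implementsD u I_intros)+
    finally show ?case .
  qed (simp add: ideal_zero[OF enveloping_ideal_ideal])
  then show "((\<lambda>z. u * z - z * u) ^^ p) (gen x) - gen ((D ^^ p) x) \<in> I"
    by (simp add: A_def)
qed

end

lemma (in lie_algebra) restricted_closure_implements:
  assumes p: "CHAR('k) = p" "p > 0" and D: "D \<in> restricted_closure p scale br"
  shows "\<exists>u. implements scale br u D"
proof -
  \<comment> \<open>In each closure property of \<open>S\<close> the membership in the derivations
    comes from \<open>Der\<close> and the implementing element from the preceding lemmas.\<close>
  define S where "S = {D \<in> derivations scale br. \<exists>u. implements scale br u D}"
  note Der = derivations_restricted[OF p, unfolded restricted_subalgebra_of_derivations_def]
  have diff: "gen (x - y) - (gen x - gen y) \<in> enveloping_ideal scale br" for x y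
    using ideal_uminus[OF enveloping_ideal_ideal enveloping_add[of "x - y" y scale br]]
    by (simp add: algebra_simps)
  have "restricted_subalgebra_of_derivations p scale br S"
    unfolding restricted_subalgebra_of_derivations_def
  proof (intro conjI allI ballI)
    show "S \<subseteq> derivations scale br" "(\<lambda>x. 0) \<in> S"
      using Der implements_zero[of scale br] unfolding S_def by blast+
  next
    fix D E assume DE: "D \<in> S" "E \<in> S"
    then obtain u v where uv: "implements scale br u D" "implements scale br v E"
      unfolding S_def by blast
    have "D \<in> derivations scale br" "E \<in> derivations scale br"
      using DE by (simp_all add: S_def)
    then show "(\<lambda>x. D x + E x) \<in> S" "(\<lambda>x. D (E x) - E (D x)) \<in> S"
      using Der implements_add[OF uv] implements_commutator[OF uv diff] unfolding S_def by blast+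
  next
    fix c D assume "D \<in> S"
    then show "(\<lambda>x. scale c (D x)) \<in> S"
      using Der implements_scale[of scale br _ D c] unfolding S_def by blast
  next
    fix D assume "D \<in> S"
    then show "D ^^ p \<in> S"
      using Der implements_power_CHAR[of scale br _ D, OF _ p] unfolding S_def by blast
  qed
  moreover have "range br \<subseteq> S"
    using ad_derivations implements_ad unfolding S_def by blast
  ultimately show ?thesis
    using D unfolding restricted_closure_def S_def by blast
qed


subsection \<open>Change of the derivation\<close>

context lie_algebra
begin

text \<open>A lift to free algebras of the map from \<open>U(L)\<close> to \<open>U(L_D)\<close>;
  one formula serves for every \<open>D\<close>.\<close>

definition incl :: "('l list \<Rightarrow>\<^sub>0 'k) \<Rightarrow> ('l \<times> 'k) list \<Rightarrow>\<^sub>0 'k" where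
  "incl = subst (\<lambda>x. gen (x, 0))"

text \<open>Fixes \<open>L\<close> up to the relations and replaces the formal vector
  \<open>D\<close>, which is \<open>(0, 1)\<close>, by \<open>D + w\<close>.\<close>

definition shift :: "(('l \<times> 'k) list \<Rightarrow>\<^sub>0 'k) \<Rightarrow> 'l \<times> 'k \<Rightarrow> ('l \<times> 'k) list \<Rightarrow>\<^sub>0 'k" where
  "shift w = (\<lambda>(x, a). gen (x, 0) + scalar a * (gen (0, 1) + w))"

text \<open>The letters of \<open>incl P\<close> have second coordinate zero, so \<open>w\<close>
  never appears. Hence two successive shifts simply add their parameters.\<close>

lemma subst_shift_incl: "subst (shift w) (incl P) = incl P"
  by (simp add: incl_def subst_subst shift_def)

abbreviation semidirect_ideal :: "('l \<Rightarrow> 'l) \<Rightarrow> (('l \<times> 'k) list \<Rightarrow>\<^sub>0 'k) set" where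
  "semidirect_ideal D \<equiv> enveloping_ideal (semidirect_scale scale) (semidirect_bracket scale br D)"

context
  fixes D :: "'l \<Rightarrow> 'l" assumes D: "D \<in> derivations scale br"
begin

private lemma D_zero: "D 0 = 0"
proof -
  interpret Vector_Spaces.linear scale scale D
    using D by (simp add: derivations_def)
  show ?thesis by (rule zero)
qed

private lemmas J_intros =
  ideal_add[OF enveloping_ideal_ideal] ideal_diff[OF enveloping_ideal_ideal]
  ideal_mult_left[OF enveloping_ideal_ideal]

lemma semidirect_add: "gen (x + y, 0) - (gen (x, 0) + gen (y, 0)) \<in> semidirect_ideal D"
  using enveloping_add[of "(x, 0)" "(y, 0)" "semidirect_scale scale" "semidirect_bracket scale br D"]
  by simp

lemma semidirect_scale: "gen (scale c x, 0) - scalar c * gen (x, 0) \<in> semidirect_ideal D"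
  using enveloping_scale[of "semidirect_scale scale" c "(x, 0)" "semidirect_bracket scale br D"]
  by (simp add: semidirect_scale_def)

lemma semidirect_br:
  "gen (x, 0) * gen (y, 0) - gen (y, 0) * gen (x, 0) - gen (br x y, 0) \<in> semidirect_ideal D"
  using enveloping_br[of "(x, 0)" "(y, 0)" "semidirect_bracket scale br D" "semidirect_scale scale"]
  by (simp add: semidirect_bracket_def)

lemma semidirect_derivation:
  "gen (0, 1) * gen (x, 0) - gen (x, 0) * gen (0, 1) - gen (D x, 0) \<in> semidirect_ideal D"
  using enveloping_br[of "(0, 1)" "(x, 0)" "semidirect_bracket scale br D" "semidirect_scale scale"]
  by (simp add: semidirect_bracket_def D_zero)

lemma incl_enveloping_ideal:
  assumes "P \<in> enveloping_ideal scale br"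
  shows "incl P \<in> semidirect_ideal D"
  unfolding incl_def
  by (rule subst_enveloping_ideal[OF enveloping_ideal_ideal _ _ _ assms])
     (rule semidirect_add semidirect_scale semidirect_br)+

lemma incl_implements:
  assumes "implements scale br u E"
  shows "incl u * gen (x, 0) - gen (x, 0) * incl u - gen (E x, 0) \<in> semidirect_ideal D"
  using assms incl_enveloping_ideal[of "u * gen x - gen x * u - gen (E x)"]
  by (simp add: implements_def incl_def subst_diff subst_mult)

text \<open>In \<open>U(L_D)\<close> the element \<open>D + u - v\<close> has commutator
  \<open>D x + E x - D x = E x\<close> with \<open>x\<close> in \<open>L\<close>, so it satisfies
  the relations imposed on the formal vector of \<open>L_E\<close>.\<close>

lemma subst_shift_enveloping_ideal:
  assumes u: "implements scale br u E" and v: "implements scale br v D"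
    and P: "P \<in> semidirect_ideal E"
  shows "subst (shift (incl u - incl v)) P \<in> semidirect_ideal D"
proof (rule subst_enveloping_ideal[OF enveloping_ideal_ideal _ _ _ P])
  \<comment> \<open>This \<open>w\<close> is the image of the whole formal vector, not just the
    parameter of the shift.\<close>
  define w where "w = gen (0, 1) + (incl u - incl v)"
  define g :: "'l \<Rightarrow> ('l \<times> 'k) list \<Rightarrow>\<^sub>0 'k" where "g x = gen (x, 0)" for x
  note J = semidirect_add[folded g_def] semidirect_scale[folded g_def] semidirect_br[folded g_def]
  have shift: "shift (incl u - incl v) (x, a) = g x + scalar a * w" for x a
    by (simp add: shift_def w_def g_def)
  have w: "w * g x - g x * w - g (E x) \<in> semidirect_ideal D" for x
  proof -
    have "w * g x - g x * w - g (E x) =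
        (gen (0, 1) * g x - g x * gen (0, 1) - g (D x)) +
        (incl u * g x - g x * incl u - g (E x)) - (incl v * g x - g x * incl v - g (D x))"
      by (simp add: w_def algebra_simps)
    also have "\<dots> \<in> semidirect_ideal D"
      unfolding g_def by (rule semidirect_derivation incl_implements u v J_intros)+
    finally show ?thesis .
  qed
  show "shift (incl u - incl v) (z1 + z2) - (shift (incl u - incl v) z1 + shift (incl u - incl v) z2)
      \<in> semidirect_ideal D" for z1 z2
    using J(1)[of "fst z1" "fst z2"]
    by (cases z1; cases z2) (simp add: shift scalar_add algebra_simps)
  show "shift (incl u - incl v) (semidirect_scale scale c z1) - scalar c * shift (incl u - incl v) z1
      \<in> semidirect_ideal D" for c z1
    using J(2)[of c "fst z1"]
    by (cases z1) (simp add: shift semidirect_scale_def scalar_mult algebra_simps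
        scalar_left_commute[of "scalar c"])
  fix z1 z2 :: "'l \<times> 'k"
  obtain x a y b where z: "z1 = (x, a)" "z2 = (y, b)"
    by (cases z1; cases z2)
  define s where "s = br x y + scale a (E y)"
  let ?t = "br x y + scale a (E y) - scale b (E x)"
  \<comment> \<open>The terms in \<open>w * w\<close> cancel because scalars are central. Since
    \<open>?t + scale b (E x)\<close> equals \<open>s\<close>, the difference \<open>?t\<close> is
    handled by additivity alone.\<close>
  have "(g x + scalar a * w) * (g y + scalar b * w) - (g y + scalar b * w) * (g x + scalar a * w) - g ?t =
      (g x * g y - g y * g x - g (br x y)) + scalar a * (w * g y - g y * w - g (E y)) -
      scalar b * (w * g x - g x * w - g (E x)) -
      (g s - (g (br x y) + g (scale a (E y)))) + (g (?t + scale b (E x)) - (g ?t + g (scale b (E x))))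
      - (g (scale a (E y)) - scalar a * g (E y)) + (g (scale b (E x)) - scalar b * g (E x))"
    by (simp add: s_def algebra_simps scalar_left_commute[of _ a] scalar_left_commute[of "g _"]
        scalar_left_commute[of w])
  also have "\<dots> \<in> semidirect_ideal D"
    unfolding s_def by (rule J w J_intros)+
  finally show "shift (incl u - incl v) z1 * shift (incl u - incl v) z2 -
      shift (incl u - incl v) z2 * shift (incl u - incl v) z1 -
      shift (incl u - incl v) (semidirect_bracket scale br E z1 z2) \<in> semidirect_ideal D"
    by (simp add: z shift semidirect_bracket_def)
qed

text \<open>The parameters of the two shifts cancel. What remains is to split \<open>(x, a)\<close>
  along \<open>L\<close> and the formal vector, plus a multiple of \<open>gen 0\<close> that arises
  from shifting \<open>(0, 1)\<close>.\<close>

lemma subst_shift_inverse: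
  "subst (shift (incl v - incl u)) (shift (incl u - incl v) z) - gen z \<in> semidirect_ideal D"
proof -
  obtain x a where z: "z = (x, a)" by (cases z)
  let ?sc = "semidirect_scale scale" and ?br = "semidirect_bracket scale br D"
  have "subst (shift (incl v - incl u)) (shift (incl u - incl v) z) - gen z =
      scalar a * gen 0 -
      (gen ((x, 0) + ?sc a (0, 1)) - (gen (x, 0) + gen (?sc a (0, 1)))) -
      (gen (?sc a (0, 1)) - scalar a * gen (0, 1))"
    unfolding z shift_def[of "incl u - incl v"]
    by (simp add: subst_add subst_mult subst_diff subst_shift_incl)
       (simp add: shift_def scalar_one semidirect_scale_def zero_prod_def algebra_simps)
  also have "\<dots> \<in> semidirect_ideal D"
    by (rule enveloping_zero enveloping_add enveloping_scale J_intros)+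
  finally show ?thesis .
qed

end

end

theorem proposition2:
  fixes scale :: "'k::alg_closed_field \<Rightarrow> 'l::ab_group_add \<Rightarrow> 'l"
    and br :: "'l \<Rightarrow> 'l \<Rightarrow> 'l"
    and p :: nat
  assumes "CHAR('k) = p" and "p > 0"
    and "lie_algebra scale br"
    and "\<exists>B. finite_dimensional_vector_space scale B"
    and "D \<in> restricted_closure p scale br"
    and "D' \<in> restricted_closure p scale br"
  shows "algebra_isomorphic
    (universal_enveloping_algebra (semidirect_scale scale) (semidirect_bracket scale br D))
    (universal_enveloping_algebra (semidirect_scale scale) (semidirect_bracket scale br D'))"
proof -
  interpret lie_algebra scale br by fact
  have der: "D \<in> derivations scale br" "D' \<in> derivations scale br"
    using restricted_closure_subset[OF assms(1,2)] assms(5,6) by auto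
  obtain u u' where u: "implements scale br u D" "implements scale br u' D'"
    using restricted_closure_implements[OF assms(1,2)] assms(5,6) by metis
  show ?thesis
    \<comment> \<open>Both directions, and both composites, are instances of the same two lemmas
      with \<open>D\<close> and \<open>D'\<close> exchanged.\<close>
    by (rule algebra_isomorphicI[where f = "shift (incl u - incl u')" and g = "shift (incl u' - incl u)"])
       (rule subst_shift_enveloping_ideal subst_shift_inverse der u | assumption)+
qed

end
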